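(* Let $F \subset \mathbb{R}$ be non-empty and fix an integer $k \geq 3$ and $\varepsilon \in (0,1)$. If $F$ does not contain any $(k,\varepsilon)$-APs, then $$\dim_{\mathrm{A}} F \leq 1 + \frac{\log (1-1/k)}{\log \left( k \lceil 1/(2\varepsilon)\rceil \right)}.$$
   Context: An arithmetic progression of length $k$ with gap length $\Delta>0$ is a collection $\{a_i\}_{i=0}^{k-1} \subset \mathbb{R}$ with $a_i = a_0 + i\Delta$ for $i=1,\dots,k-1$. For $\varepsilon \geq 0$, a collection of points $\{b_i\}_{i=0}^{k-1} \subset \mathbb{R}$ is a $(k,\varepsilon)$-AP if there exists an arithmetic progression $\{a_i\}_{i=0}^{k-1}$ with some gap length $\Delta>0$ such that $|a_i - b_i| \leq \varepsilon \Delta$ for all $i = 0,1,\dots,k-1$. A set $F$ contains a $(k,\varepsilon)$-AP if there is a $(k,\varepsilon)$-AP $\{b_i\}_{i=0}^{k-1}$ with $b_i \in F$ for all $i$. For a real number $x \ge 0$, $\lceil x \rceil$ is the smallest integer greater than or equal to $x$. For a non-empty bounded set $E \subset \mathbb{R}^d$ and $r>0$, $N(E,r)$ denotes the smallest number of open sets of diameter at most $r$ required to cover $E$. The Assouad dimension of a non-empty set $F \subseteq \mathbb{R}^d$ is $$\dim_{\mathrm{A}} F = \inf\left\{ s \geq 0 : (\exists C>0)(\forall R>0)(\forall r \in (0,R))(\forall x \in F)\ N(B(x,R)\cap F, r) \leq C \left(\frac{R}{r}\right)^s \right\},$$ where $B(x,R)$ is the closed ball with centre $x$ and radius $R$. 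*)

theory Defs
  imports "HOL-Analysis.Analysis"
begin

text \<open>Collections \<open>{a\<^sub>0, \<dots>, a\<^sub>k\<^sub>-\<^sub>1}\<close> are families indexed by the naturals below \<open>k\<close>, given as
  functions on the naturals of which only the values below \<open>k\<close> matter.  In particular the
  points of an approximate progression are not required to be distinct.\<close>

definition is_AP :: "nat \<Rightarrow> real \<Rightarrow> (nat \<Rightarrow> real) \<Rightarrow> bool" where
  "is_AP k \<Delta> a \<longleftrightarrow> \<Delta> > 0 \<and> (\<forall>i<k. a i = a 0 + real i * \<Delta>)"

definition is_approx_AP :: "nat \<Rightarrow> real \<Rightarrow> (nat \<Rightarrow> real) \<Rightarrow> bool" where
  "is_approx_AP k \<epsilon> b \<longleftrightarrow> (\<exists>a \<Delta>. is_AP k \<Delta> a \<and> (\<forall>i<k. \<bar>a i - b i\<bar> \<le> \<epsilon> * \<Delta>))"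

definition contains_approx_AP :: "real set \<Rightarrow> nat \<Rightarrow> real \<Rightarrow> bool" where
  "contains_approx_AP F k \<epsilon> \<longleftrightarrow> (\<exists>b. is_approx_AP k \<epsilon> b \<and> (\<forall>i<k. b i \<in> F))"

text \<open>Boundedness of the covering sets is explicit because \<^const>\<open>diameter\<close> is a real number and
  has no meaningful value on unbounded sets.  For bounded \<open>E\<close> and \<open>r > 0\<close>, a finite cover of
  this kind exists, so the minimum is attained.\<close>

definition covering_number :: "'a::euclidean_space set \<Rightarrow> real \<Rightarrow> nat" where
  "covering_number E r =
     (LEAST n. \<exists>\<U>. finite \<U> \<and> card \<U> = n \<and>
        (\<forall>U\<in>\<U>. open U \<and> bounded U \<and> diameter U \<le> r) \<and> E \<subseteq> \<Union>\<U>)"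

text \<open>The infimum is taken over a set of reals that is bounded below by \<open>0\<close> and is non-empty
  (it contains the dimension of the ambient space), so \<^const>\<open>Inf\<close> is the true infimum.\<close>

definition assouad_dim :: "'a::euclidean_space set \<Rightarrow> real" where
  "assouad_dim F =
     Inf {s. s \<ge> 0 \<and> (\<exists>C>0. \<forall>R>0. \<forall>r\<in>{0<..<R}. \<forall>x\<in>F.
        real (covering_number (cball x R \<inter> F) r) \<le> C * (R / r) powr s)}"

end

(* Cut an interval into k m pieces of equal length, where m = ceiling (1 / (2 eps)). The
   midpoints of the pieces whose index lies in a fixed residue class mod m form an arithmetic
   progression of length k, and half the length of a piece is at most eps times the gap. So each of
   the m classes contains a piece that misses F, and at most (k - 1) m of the k m pieces meet F.
   Iterating bounds the Assouad dimension by ln ((k - 1) m) / ln (k m). *)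

theory Submission
  imports Defs
begin

lemma covering_number_le_card:
  assumes "finite \<U>" "\<And>U. U \<in> \<U> \<Longrightarrow> open U \<and> bounded U \<and> diameter U \<le> r" "E \<subseteq> \<Union>\<U>"
  shows "covering_number E r \<le> card \<U>"
  unfolding covering_number_def using assms by (intro Least_le) blast

lemma assouad_dim_le:
  assumes "s \<ge> 0" "C > 0"
    and "\<And>R r x. \<lbrakk>0 < r; r < R; x \<in> F\<rbrakk> \<Longrightarrow>
           real (covering_number (cball x R \<inter> F) r) \<le> C * (R / r) powr s"
  shows "assouad_dim F \<le> s"
  unfolding assouad_dim_def
proof (rule cInf_lower)
  show "s \<in> {s. s \<ge> 0 \<and> (\<exists>C>0. \<forall>R>0. \<forall>r\<in>{0<..<R}. \<forall>x\<in>F.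
        real (covering_number (cball x R \<inter> F) r) \<le> C * (R / r) powr s)}"
    using assms by auto
qed (auto intro: bdd_belowI)

text \<open>Closed at both ends, so that finitely many pieces cover a closed interval and each piece
  is again an interval that can be subdivided. Neighbours share an endpoint, which does no harm to
  the counting of indices.\<close>

definition subinterval :: "real \<Rightarrow> real \<Rightarrow> nat \<Rightarrow> real set" where
  "subinterval a \<delta> j = {a + real j * \<delta>..a + real j * \<delta> + \<delta>}"

lemma interval_subset_subintervals:
  assumes "\<delta> > 0" "n > 0"
  shows "{a..a + real n * \<delta>} \<subseteq> (\<Union>j<n. subinterval a \<delta> j)"
proof
  fix x assume x: "x \<in> {a..a + real n * \<delta>}"
  define t where "t = (x - a) / \<delta>"
  have xt: "x = a + t * \<delta>" and t: "0 \<le> t" "t \<le> real n"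
    using assms x by (auto simp: t_def field_simps)
  have "\<exists>j<n. real j \<le> t \<and> t \<le> real j + 1"
  proof (cases "t = real n")
    case True
    \<comment> \<open>The right endpoint belongs to the last piece; the floor of \<open>t\<close>
      would give the index \<open>n\<close>, one too large.\<close>
    then show ?thesis using assms by (intro exI[of _ "n - 1"]) (auto simp: of_nat_diff)
  next
    case False
    then show ?thesis using t by (intro exI[of _ "nat \<lfloor>t\<rfloor>"]) linarith
  qed
  then obtain j where j: "j < n" "real j \<le> t" "t \<le> real j + 1" by blast
  have "real j * \<delta> \<le> t * \<delta>" "t * \<delta> \<le> (real j + 1) * \<delta>"
    using j assms by (auto intro: mult_right_mono)
  then show "x \<in> (\<Union>j<n. subinterval a \<delta> j)"
    using j xt by (auto simp: subinterval_def algebra_simps)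
qed

lemma subinterval_in_residue_class_disjoint:
  assumes "\<not> contains_approx_AP F k \<epsilon>" "\<delta> > 0" "m > 0" "1 \<le> 2 * real m * \<epsilon>"
  shows "\<exists>i<k. F \<inter> subinterval a \<delta> (c + i * m) = {}"
proof (rule ccontr)
  assume "\<not> ?thesis"
  then have "\<forall>i. \<exists>x. i < k \<longrightarrow> x \<in> F \<inter> subinterval a \<delta> (c + i * m)" by blast
  then obtain b where b: "\<And>i. i < k \<Longrightarrow> b i \<in> F \<inter> subinterval a \<delta> (c + i * m)" by metis
  \<comment> \<open>Midpoints are never further than \<delta> / 2 from a point of their piece. This
    half is the source of the 2 in ceiling (1 / (2 eps)).\<close>
  define A where "A i = a + real (c + i * m) * \<delta> + \<delta> / 2" for i
  have "is_AP k (real m * \<delta>) A"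
    using assms by (auto simp: is_AP_def A_def algebra_simps)
  moreover have "\<bar>A i - b i\<bar> \<le> \<epsilon> * (real m * \<delta>)" if "i < k" for i
  proof -
    have "\<bar>A i - b i\<bar> \<le> \<delta> / 2"
      using b[OF that] unfolding A_def subinterval_def Int_iff atLeastAtMost_iff by arith
    also have "\<dots> \<le> \<epsilon> * (real m * \<delta>)"
      using mult_right_mono[OF assms(4), of \<delta>] assms(2) by (simp add: algebra_simps)
    finally show ?thesis .
  qed
  ultimately have "is_approx_AP k \<epsilon> b" unfolding is_approx_AP_def by blast
  then show False using assms(1) b unfolding contains_approx_AP_def by blast
qed

lemma card_subintervals_meeting_le:
  assumes "\<not> contains_approx_AP F k \<epsilon>" "\<delta> > 0" "m > 0" "1 \<le> 2 * real m * \<epsilon>"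
  shows "card {j. j < k * m \<and> F \<inter> subinterval a \<delta> j \<noteq> {}} \<le> (k - 1) * m"
proof -
  let ?J = "{j. j < k * m \<and> F \<inter> subinterval a \<delta> j \<noteq> {}}"
  let ?J' = "{j. j < k * m \<and> F \<inter> subinterval a \<delta> j = {}}"
  obtain g where g: "\<And>c. g c < k" "\<And>c. F \<inter> subinterval a \<delta> (c + g c * m) = {}"
    using subinterval_in_residue_class_disjoint[OF assms] by metis
  \<comment> \<open>\<open>h c\<close> is the index of a piece missing \<open>F\<close> in the class
    of \<open>c\<close>. For \<open>c < m\<close> its residue mod \<open>m\<close> is
    \<open>c\<close>, so these \<open>m\<close> indices are distinct.\<close>
  define h where "h c = c + g c * m" for c
  have "inj_on h {..<m}"
    by (rule inj_onI) (metis h_def lessThan_iff mod_less mod_mult_self1)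
  moreover have "h ` {..<m} \<subseteq> ?J'"
  proof -
    have "h c < k * m" if "c < m" for c
    proof -
      have "h c < Suc (g c) * m" using that by (simp add: h_def)
      also have "\<dots> \<le> k * m" using g(1)[of c] by (intro mult_right_mono) auto
      finally show ?thesis .
    qed
    then show ?thesis using g(2) by (auto simp: h_def)
  qed
  ultimately have "m \<le> card ?J'"
    using card_inj_on_le[of h "{..<m}" ?J'] by simp
  moreover have "card ?J + card ?J' = card (?J \<union> ?J')"
    by (rule card_Un_disjoint[symmetric]) auto
  moreover have "?J \<union> ?J' = {..<k * m}" by auto
  ultimately show ?thesis by (simp add: diff_mult_distrib)
qed

text \<open>Being free of approximate progressions does not depend on position or scale, so the
  count for one subdivision applies afresh to every surviving piece. Hence the induction on the
  depth \<open>n\<close> leaves \<open>a\<close> and \<open>L\<close> arbitrary. \<open>S\<close>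
  holds the left endpoints of the surviving pieces.\<close>

lemma cover_by_short_intervals:
  assumes "\<not> contains_approx_AP F k \<epsilon>" "k > 0" "m > 0" "1 \<le> 2 * real m * \<epsilon>" "L > 0"
  shows "\<exists>S. finite S \<and> card S \<le> ((k - 1) * m) ^ n \<and>
           {a..a + L} \<inter> F \<subseteq> (\<Union>c\<in>S. {c..c + L / real (k * m) ^ n})"
  using assms(5)
proof (induction n arbitrary: a L)
  case 0
  show ?case by (intro exI[of _ "{a}"]) auto
next
  case (Suc n)
  define \<delta> where "\<delta> = L / real (k * m)"
  have km: "k * m > 0" and \<delta>: "\<delta> > 0" and L: "L = real (k * m) * \<delta>"
    using assms Suc.prems by (auto simp: \<delta>_def)
  define J where "J = {j. j < k * m \<and> F \<inter> subinterval a \<delta> j \<noteq> {}}"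
  have J: "finite J" "card J \<le> (k - 1) * m"
    unfolding J_def using card_subintervals_meeting_le[OF assms(1) \<delta> assms(3,4)] by auto
  have "\<exists>S. finite S \<and> card S \<le> ((k - 1) * m) ^ n \<and>
      subinterval a \<delta> j \<inter> F \<subseteq> (\<Union>c\<in>S. {c..c + \<delta> / real (k * m) ^ n})" for j
    unfolding subinterval_def by (rule Suc.IH[OF \<delta>])
  then obtain S where S: "\<And>j. finite (S j)" "\<And>j. card (S j) \<le> ((k - 1) * m) ^ n"
    "\<And>j. subinterval a \<delta> j \<inter> F \<subseteq> (\<Union>c\<in>S j. {c..c + \<delta> / real (k * m) ^ n})"
    by metis
  have "card (\<Union>j\<in>J. S j) \<le> (\<Sum>j\<in>J. card (S j))" by (rule card_UN_le[OF J(1)])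
  also have "\<dots> \<le> card J * ((k - 1) * m) ^ n"
    using sum_bounded_above[of J "\<lambda>j. card (S j)"] S(2) by simp
  also have "\<dots> \<le> ((k - 1) * m) ^ Suc n" using J(2) by (simp add: mult_right_mono)
  finally have "card (\<Union>j\<in>J. S j) \<le> ((k - 1) * m) ^ Suc n" .
  moreover have "{a..a + L} \<inter> F \<subseteq> (\<Union>c\<in>(\<Union>j\<in>J. S j). {c..c + \<delta> / real (k * m) ^ n})"
  proof
    fix x assume x: "x \<in> {a..a + L} \<inter> F"
    then obtain j where j: "j < k * m" "x \<in> subinterval a \<delta> j"
      using interval_subset_subintervals[OF \<delta> km, of a] unfolding L by blast
    then have "j \<in> J" using x by (auto simp: J_def)
    then show "x \<in> (\<Union>c\<in>(\<Union>j\<in>J. S j). {c..c + \<delta> / real (k * m) ^ n})"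
      using S(3)[of j] j x by blast
  qed
  moreover have "\<delta> / real (k * m) ^ n = L / real (k * m) ^ Suc n" by (simp add: \<delta>_def)
  ultimately show ?case using J(1) S(1) by (intro exI[of _ "\<Union>j\<in>J. S j"]) simp
qed

lemma power_between:
  fixes K y :: real
  assumes "K > 1" "y > 1"
  shows "\<exists>n. y \<le> K ^ n \<and> K ^ n \<le> K * y"
proof -
  define n where "n = (LEAST n. y \<le> K ^ n)"
  have "\<exists>n. y \<le> K ^ n" using real_arch_pow[OF assms(1), of y] by (auto intro: less_imp_le)
  then have n: "y \<le> K ^ n" unfolding n_def by (rule LeastI_ex)
  \<comment> \<open>Since \<open>y > 1\<close>, the least exponent is not 0; by minimality its
    predecessor satisfies \<open>K ^ p < y\<close>, and multiplying by \<open>K\<close> gives the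
    upper bound.\<close>
  then obtain p where p: "n = Suc p" using assms(2) by (cases n) auto
  have "\<not> y \<le> K ^ p" using not_less_Least[of p "\<lambda>n. y \<le> K ^ n"] p by (simp add: n_def)
  then show ?thesis using n p assms by (intro exI[of _ n]) auto
qed

text \<open>The depth \<open>n\<close> is chosen with \<open>K ^ n\<close> comparable to
  \<open>R / r\<close>. By the choice of \<open>s\<close>, the number ((k - 1) m) ^ n of surviving
  pieces is exactly \<open>(K ^ n) powr s\<close>.\<close>

lemma covering_number_le_powr:
  assumes AP: "\<not> contains_approx_AP F k \<epsilon>" and m: "m > 0" "1 \<le> 2 * real m * \<epsilon>"
    and k: "k \<ge> 2" and r: "0 < r" "r < R"
    and s: "s \<ge> 0" "real (k * m) powr s = real ((k - 1) * m)"
  shows "real (covering_number (cball x R \<inter> F) r) \<le> (4 * real (k * m)) powr s * (R / r) powr s"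
proof -
  define K where "K = real (k * m)"
  have "k * 1 \<le> k * m" using m by (intro mult_left_mono) auto
  then have K: "K > 1" unfolding K_def using k by linarith
  \<comment> \<open>The 4 is a product of two doublings: the ball is an interval of length
    \<open>2 * R\<close>, and each closed piece of length \<delta> is later enlarged to an open set
    of diameter 2 \<delta>, which must be at most \<open>r\<close>.\<close>
  have "4 * R / r > 1" using r by simp
  then obtain n where n: "4 * R / r \<le> K ^ n" "K ^ n \<le> K * (4 * R / r)"
    using power_between[OF K] by blast
  define \<delta> where "\<delta> = 2 * R / K ^ n"
  have \<delta>: "\<delta> > 0" "2 * \<delta> \<le> r"
    using K r n(1) by (auto simp: \<delta>_def field_simps)
  obtain S where S: "finite S" "card S \<le> ((k - 1) * m) ^ n"
    "{x - R..x - R + 2 * R} \<inter> F \<subseteq> (\<Union>c\<in>S. {c..c + \<delta>})"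
    using cover_by_short_intervals[OF AP _ m, of "2 * R" n "x - R"] k r
    unfolding \<delta>_def K_def by auto
  \<comment> \<open>Radius \<delta> instead of \<delta> / 2 makes the open ball contain both
    endpoints of the piece.\<close>
  let ?\<U> = "(\<lambda>c. ball (c + \<delta> / 2) \<delta>) ` S"
  have "cball x R \<inter> F \<subseteq> (\<Union>c\<in>S. {c..c + \<delta>})"
    using S(3) by (simp add: cball_eq_atLeastAtMost add.commute)
  also have "\<dots> \<subseteq> \<Union>?\<U>"
    using \<delta>(1) by (fastforce simp: dist_real_def abs_less_iff)
  finally have "covering_number (cball x R \<inter> F) r \<le> card ?\<U>"
    using S(1) \<delta> by (intro covering_number_le_card) auto
  also have "\<dots> \<le> card S" by (rule card_image_le[OF S(1)])
  also have "\<dots> \<le> ((k - 1) * m) ^ n" by (rule S(2))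
  finally have "real (covering_number (cball x R \<inter> F) r) \<le> real ((k - 1) * m) ^ n"
    by (metis of_nat_le_iff of_nat_power)
  also have "\<dots> = (K powr s) ^ n" by (simp only: s(2) K_def)
  also have "\<dots> = (K ^ n) powr s"
    using K by (simp add: powr_realpow[symmetric] powr_powr mult.commute)
  also have "\<dots> \<le> (4 * K * (R / r)) powr s"
    using n(2) K s(1) by (intro powr_mono2) (auto simp: algebra_simps)
  also have "\<dots> = (4 * K) powr s * (R / r) powr s"
    by (rule powr_mult)
  finally show ?thesis unfolding K_def .
qed

theorem theorem2p1:
  fixes F :: "real set" and k :: nat and \<epsilon> :: real
  assumes "F \<noteq> {}"
    and "k \<ge> 3"
    and "\<epsilon> \<in> {0<..<1}"
    and "\<not> contains_approx_AP F k \<epsilon>"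
  shows "assouad_dim F \<le> 1 + ln (1 - 1 / real k) / ln (real k * real_of_int \<lceil>1 / (2 * \<epsilon>)\<rceil>)"
proof -
  define m where "m = nat \<lceil>1 / (2 * \<epsilon>)\<rceil>"
  have \<epsilon>: "\<epsilon> > 0" using assms(3) by simp
  then have "\<lceil>1 / (2 * \<epsilon>)\<rceil> > 0" by simp
  then have m: "m > 0" and mc: "real_of_int \<lceil>1 / (2 * \<epsilon>)\<rceil> = real m"
    by (auto simp: m_def)
  have "1 / (2 * \<epsilon>) \<le> real m" unfolding mc[symmetric] by (rule le_of_int_ceiling)
  then have m\<epsilon>: "1 \<le> 2 * real m * \<epsilon>" using \<epsilon> by (simp add: field_simps)
  have m1: "real m \<ge> 1" using m by simp
  define K where "K = real (k * m)"
  define M where "M = real ((k - 1) * m)"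
  \<comment> \<open>\<open>K > 1\<close> makes the denominator \<open>ln K\<close> positive, and
    \<open>M > 1\<close> makes the exponent \<open>s\<close> nonnegative, as the definition of the
    dimension demands.\<close>
  have "3 * 1 \<le> real k * real m" "2 * 1 \<le> (real k - 1) * real m"
    using assms(2) m1 by (intro mult_mono; simp)+
  then have K: "K > 1" and M: "M > 1"
    using assms(2) by (auto simp: K_def M_def of_nat_diff)
  \<comment> \<open>The solution of \<open>K powr s = M\<close>. It equals the claimed bound because
    1 - 1/k = M / K.\<close>
  define s where "s = ln M / ln K"
  have s0: "s \<ge> 0" using K M by (simp add: s_def)
  have Ks: "K powr s = M" using K M by (simp add: s_def powr_def)
  have "1 - 1 / real k = M / K"
    using assms(2) m by (simp add: K_def M_def of_nat_diff field_simps)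
  then have "ln (1 - 1 / real k) = ln M - ln K" using K M by (simp add: ln_div)
  then have "1 + ln (1 - 1 / real k) / ln K = s" using K by (simp add: s_def field_simps)
  moreover have "assouad_dim F \<le> s"
  proof (rule assouad_dim_le[OF s0])
    show "(4 * K) powr s > 0" using K by simp
    show "real (covering_number (cball x R \<inter> F) r) \<le> (4 * K) powr s * (R / r) powr s"
      if "0 < r" "r < R" for R r x
      using covering_number_le_powr[OF assms(4) m m\<epsilon> _ that s0] assms(2) Ks
      by (simp add: K_def M_def)
  qed
  ultimately show ?thesis by (simp add: mc K_def)
qed

end
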